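(* For an integer $g\ge1$ put $m(g):=\left[\frac{g-1}{4}\right]+1$, where $[\cdot]$ is the integer part. Then $$Z(\mathfrak{a}_g^-)+N(\widehat{T}_{2m(g)})=\bigoplus_{m=2}^\infty\mathbb{Q}\,N(\omega^m)+N(\widehat{T}_{2m(g)})$$ as subspaces of $N(\widehat T_1)=\mathfrak{a}_g^-$, where $Z(\mathfrak{a}_g^-)$ is the center of the Lie algebra $\mathfrak{a}_g^-$.
   Context: Let $H=H_1(\Sigma_{g,1};\mathbb{Q})$, where $\Sigma_{g,1}$ is a compact connected oriented surface of genus $g$ with one boundary component; $H$ is a $2g$-dimensional $\mathbb{Q}$-vector space with the intersection pairing $(\ \cdot\ )$, a nondegenerate alternating form. Let $\{A_i,B_i\}_{i=1}^g$ be a symplectic basis ($A_i\cdot B_j=\delta_{ij}$, $A_i\cdot A_j=B_i\cdot B_j=0$) and $\omega=\sum_{i=1}^g(A_iB_i-B_iA_i)\in H^{\otimes2}$ (tensor signs omitted). Let $\widehat T=\prod_{m\ge0}H^{\otimes m}$ be the completed tensor algebra and $\widehat T_p=\prod_{m\ge p}H^{\otimes m}$ for $p\ge1$. The linear map $N\colon\widehat T\to\widehat T_1$ is defined by $N|_{H^{\otimes n}}=\sum_{k=0}^{n-1}\nu^k$ for $n\ge1$, where $\nu(X_1X_2\cdots X_n)=X_2\cdots X_nX_1$, and $N|_{H^{\otimes0}}=0$. $\mathfrak{a}_g^-=\mathrm{Der}_\omega(\widehat T)$ is the Lie algebra (under commutator) of derivations $D$ of the algebra $\widehat T$ with $D(\omega)=0$.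 A derivation is determined by its restriction to $H$, and $\widehat T_1=H\otimes\widehat T$ is identified with $\mathrm{Hom}(H,\widehat T)$ by $X\otimes u\mapsto(Y\mapsto(Y\cdot X)u)$; under this identification $\mathfrak{a}_g^-=N(\widehat T_1)$. *)

theory Defs
  imports "HOL-Analysis.Finite_Cartesian_Product" "HOL-Library.Set_Algebras"
begin

section \<open>The completed tensor algebra over a finite alphabet\<close>

text \<open>
  If \<open>H\<close> is a rational vector space with finite basis \<open>'a\<close>, then the words of length \<open>n\<close> over \<open>'a\<close>
  are a basis of the \<open>n\<close>-th tensor power of \<open>H\<close>. An element of the product of all tensor powers is
  therefore an arbitrary function from words to rationals, \<open>tcoeff u w\<close> being the coefficient of
  the word \<open>w\<close> in the component of \<open>u\<close> of degree \<open>length w\<close>.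
\<close>

typedef 'a tensor_alg = "UNIV :: ('a list \<Rightarrow> rat) set"
  morphisms tcoeff Tensor
  by simp

lemma tcoeff_Tensor [simp]: "tcoeff (Tensor f) = f"
  by (simp add: Tensor_inverse)

lemma tensor_eqI: "(\<And>w. tcoeff u w = tcoeff v w) \<Longrightarrow> u = v"
  by (metis ext tcoeff_inject)

instantiation tensor_alg :: (type) ring_1
begin

definition zero_tensor_alg :: "'a tensor_alg"
  where "0 = Tensor (\<lambda>w. 0)"

definition one_tensor_alg :: "'a tensor_alg"
  where "1 = Tensor (\<lambda>w. if w = [] then 1 else 0)"

definition plus_tensor_alg :: "'a tensor_alg \<Rightarrow> 'a tensor_alg \<Rightarrow> 'a tensor_alg"
  where "u + v = Tensor (\<lambda>w. tcoeff u w + tcoeff v w)"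

definition minus_tensor_alg :: "'a tensor_alg \<Rightarrow> 'a tensor_alg \<Rightarrow> 'a tensor_alg"
  where "u - v = Tensor (\<lambda>w. tcoeff u w - tcoeff v w)"

definition uminus_tensor_alg :: "'a tensor_alg \<Rightarrow> 'a tensor_alg"
  where "- u = Tensor (\<lambda>w. - tcoeff u w)"

definition times_tensor_alg :: "'a tensor_alg \<Rightarrow> 'a tensor_alg \<Rightarrow> 'a tensor_alg"
  where "u * v = Tensor (\<lambda>w. \<Sum>k\<le>length w. tcoeff u (take k w) * tcoeff v (drop k w))"

definition left_quotient :: "'a \<Rightarrow> 'a tensor_alg \<Rightarrow> 'a tensor_alg"
  where "left_quotient x u = Tensor (\<lambda>w. tcoeff u (x # w))"

lemma tcoeff_mult_Nil: "tcoeff (u * v) [] = tcoeff u [] * tcoeff v []"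
  by (simp add: times_tensor_alg_def)

lemma tcoeff_mult_Cons:
  "tcoeff (u * v) (x # w) = tcoeff u [] * tcoeff v (x # w) + tcoeff (left_quotient x u * v) w"
  by (simp add: times_tensor_alg_def left_quotient_def sum.atMost_Suc_shift del: sum.atMost_Suc)

lemma tcoeff_mult_linear_left:
  assumes "\<And>w. tcoeff u w = c * tcoeff v w + tcoeff v' w"
  shows "tcoeff (u * t) w = c * tcoeff (v * t) w + tcoeff (v' * t) w"
  by (simp add: times_tensor_alg_def assms sum_distrib_left sum.distrib distrib_right mult.assoc)

lemma tcoeff_mult_assoc: "tcoeff (u * v * t) w = tcoeff (u * (v * t)) w"
proof (induction w arbitrary: u)
  case Nil
  then show ?case by (simp add: tcoeff_mult_Nil)
next
  case (Cons x w)
  have "tcoeff (left_quotient x (u * v)) w' =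
      tcoeff u [] * tcoeff (left_quotient x v) w' + tcoeff (left_quotient x u * v) w'" for w'
    by (simp add: left_quotient_def[of x "u * v"] left_quotient_def[of x v] tcoeff_mult_Cons)
  then have "tcoeff (left_quotient x (u * v) * t) w =
      tcoeff u [] * tcoeff (left_quotient x v * t) w + tcoeff (left_quotient x u * v * t) w"
    by (rule tcoeff_mult_linear_left)
  then show ?case
    by (simp add: tcoeff_mult_Cons tcoeff_mult_Nil Cons.IH algebra_simps)
qed

instance
proof
  fix a b c :: "'a tensor_alg"
  show "a * b * c = a * (b * c)"
    by (rule tensor_eqI) (rule tcoeff_mult_assoc)
  show "1 * a = a"
  proof (rule tensor_eqI)
    fix w :: "'a list"
    have "tcoeff (1 * a) w = (\<Sum>k\<le>length w. if k = 0 then tcoeff a w else 0)"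
      unfolding times_tensor_alg_def one_tensor_alg_def tcoeff_Tensor
      by (rule sum.cong) auto
    then show "tcoeff (1 * a) w = tcoeff a w"
      by simp
  qed
  show "a * 1 = a"
  proof (rule tensor_eqI)
    fix w :: "'a list"
    have "tcoeff (a * 1) w = (\<Sum>k\<le>length w. if k = length w then tcoeff a w else 0)"
      unfolding times_tensor_alg_def one_tensor_alg_def tcoeff_Tensor
      by (rule sum.cong) auto
    then show "tcoeff (a * 1) w = tcoeff a w"
      by simp
  qed
  show "(0 :: 'a tensor_alg) \<noteq> 1"
  proof
    assume "(0 :: 'a tensor_alg) = 1"
    then have "tcoeff (0 :: 'a tensor_alg) [] = tcoeff 1 []"
      by (rule arg_cong)
    then show False
      by (simp add: zero_tensor_alg_def one_tensor_alg_def)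
  qed
qed (auto simp: plus_tensor_alg_def minus_tensor_alg_def uminus_tensor_alg_def zero_tensor_alg_def
  times_tensor_alg_def sum.distrib algebra_simps intro!: tensor_eqI)

end

definition tscale :: "rat \<Rightarrow> 'a tensor_alg \<Rightarrow> 'a tensor_alg"
  where "tscale c u = Tensor (\<lambda>w. c * tcoeff u w)"

global_interpretation tens: vector_space tscale
  by unfold_locales
    (auto simp: tscale_def plus_tensor_alg_def algebra_simps intro!: tensor_eqI)

text \<open>\<open>filt p\<close> is the product of the tensor powers of degree at least \<open>p\<close>.\<close>

definition filt :: "nat \<Rightarrow> 'a tensor_alg set"
  where "filt p = {u. \<forall>w. length w < p \<longrightarrow> tcoeff u w = 0}"

text \<open>
  The permutation \<open>\<nu>\<close> of tensor factors sends the basis word \<open>v\<close> to \<open>rotate1 v\<close>, so the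
  coefficient of \<open>w\<close> in \<open>\<nu> u\<close> is the coefficient in \<open>u\<close> of the \<open>v\<close> with \<open>rotate1 v = w\<close>.
\<close>

definition nu :: "'a tensor_alg \<Rightarrow> 'a tensor_alg"
  where "nu u = Tensor (\<lambda>w. tcoeff u (inv rotate1 w))"

definition cyc_N :: "'a tensor_alg \<Rightarrow> 'a tensor_alg"
  where "cyc_N u = Tensor (\<lambda>w. \<Sum>k<length w. tcoeff ((nu ^^ k) u) w)"

section \<open>The symplectic space and the symplectic element\<close>

text \<open>
  The first homology of the surface is \<open>rat ^ ('g + 'g)\<close> with \<open>CARD('g)\<close> the genus, written in
  coordinates with respect to a symplectic basis.
\<close>

type_synonym 'g H1 = "rat ^ ('g + 'g)"

definition basisA :: "'g::finite \<Rightarrow> 'g H1"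
  where "basisA i = axis (Inl i) 1"

definition basisB :: "'g::finite \<Rightarrow> 'g H1"
  where "basisB i = axis (Inr i) 1"

definition pairing :: "'g::finite H1 \<Rightarrow> 'g H1 \<Rightarrow> rat"
  where "pairing X Y = (\<Sum>i\<in>UNIV. X $ Inl i * Y $ Inr i - X $ Inr i * Y $ Inl i)"

lemma pairing_basis:
  "pairing (basisA i) (basisB j) = (if i = j then 1 else 0)"
  "pairing (basisA i) (basisA j) = 0"
  "pairing (basisB i) (basisB j) = 0"
  by (simp_all add: pairing_def basisA_def basisB_def axis_def if_distrib[of "\<lambda>x. x * _"] cong: if_cong)

lemma pairing_alternating: "pairing X X = 0"
  by (simp add: pairing_def algebra_simps)

definition incl :: "rat ^ 'a::finite \<Rightarrow> 'a tensor_alg"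
  where "incl X = Tensor (\<lambda>w. case w of [x] \<Rightarrow> X $ x | _ \<Rightarrow> 0)"

definition omega :: "('g::finite + 'g) tensor_alg"
  where "omega = (\<Sum>i\<in>UNIV. incl (basisA i) * incl (basisB i) - incl (basisB i) * incl (basisA i))"

lemma tcoeff_incl_mult:
  "tcoeff (incl X * u) [] = 0"
  "tcoeff (incl X * u) (x # w) = X $ x * tcoeff u w"
proof -
  show "tcoeff (incl X * u) [] = 0"
    by (simp add: tcoeff_mult_Nil incl_def)
  have "left_quotient x (incl X) = tscale (X $ x) 1"
    by (auto simp: left_quotient_def incl_def tscale_def one_tensor_alg_def fun_eq_iff
        intro!: tensor_eqI split: list.splits)
  moreover have "tcoeff (tscale (X $ x) 1 * u) w = X $ x * tcoeff (1 * u) w"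
    by (simp add: times_tensor_alg_def tscale_def sum_distrib_left mult.assoc)
  ultimately show "tcoeff (incl X * u) (x # w) = X $ x * tcoeff u w"
    by (simp add: tcoeff_mult_Cons incl_def)
qed

lemma nu_incl_mult:
  fixes X :: "rat ^ 'a::finite"
  shows "nu (incl X * u) = u * incl X"
proof (rule tensor_eqI)
  fix w :: "'a list"
  obtain v where w: "w = rotate1 v"
    using surj_rotate1 by blast
  have inv: "inv rotate1 w = v"
    by (simp add: w inv_f_f[OF inj_rotate1])
  show "tcoeff (nu (incl X * u)) w = tcoeff (u * incl X) w"
  proof (cases v)
    case Nil
    with w inv show ?thesis
      by (simp add: nu_def tcoeff_mult_Nil incl_def)
  next
    case (Cons x t)
    have "tcoeff (u * incl X) (t @ [x]) =
        (\<Sum>k\<le>Suc (length t). if k = length t then tcoeff u t * X $ x else 0)"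
      unfolding times_tensor_alg_def tcoeff_Tensor
    proof (rule sum.cong)
      fix k assume "k \<in> {..Suc (length t)}"
      then consider "k < length t" | "k = length t" | "k = Suc (length t)"
        by force
      then show "tcoeff u (take k (t @ [x])) * tcoeff (incl X) (drop k (t @ [x])) =
          (if k = length t then tcoeff u t * X $ x else 0)"
      proof cases
        case 1
        then obtain y z where "drop k t = y # z"
          by (metis drop_eq_Nil leD neq_Nil_conv)
        with 1 show ?thesis
          by (cases z) (simp_all add: incl_def)
      qed (simp_all add: incl_def)
    qed simp
    then show ?thesis
      using inv by (simp add: nu_def w Cons tcoeff_incl_mult mult.commute)
  qed
qed

section \<open>Symplectic derivations\<close>

text \<open>No continuity is required of a derivation: since \<open>H\<close> is finite-dimensional, it is automatic.\<close>

definition derivation :: "('a tensor_alg \<Rightarrow> 'a tensor_alg) \<Rightarrow> bool"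
  where "derivation D \<longleftrightarrow> Vector_Spaces.linear tscale tscale D \<and> (\<forall>u v. D (u * v) = D u * v + u * D v)"

definition Der_omega :: "(('g::finite + 'g) tensor_alg \<Rightarrow> ('g + 'g) tensor_alg) set"
  where "Der_omega = {D. derivation D \<and> D omega = 0}"

definition commutator :: "('v \<Rightarrow> 'v) \<Rightarrow> ('v \<Rightarrow> 'v) \<Rightarrow> 'v \<Rightarrow> 'v::ab_group_add"
  where "commutator D E = (\<lambda>u. D (E u) - E (D u))"

definition lie_center :: "('v \<Rightarrow> 'v) set \<Rightarrow> ('v \<Rightarrow> 'v::ab_group_add) set"
  where "lie_center L = {D \<in> L. \<forall>E\<in>L. commutator D E = (\<lambda>u. 0)}"

text \<open>
  The identification of \<open>filt 1\<close>, the tensor product of \<open>H\<close> and the whole algebra, with the linear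
  maps from \<open>H\<close> to the algebra: if \<open>u\<close> is the sum over the basis vectors \<open>x\<close> of \<open>x\<close> tensored with
  \<open>left_quotient x u\<close>, it sends \<open>u\<close> to \<open>Y \<mapsto> (\<Sum>x. (Y \<cdot> x) left_quotient x u)\<close>.
\<close>

definition tensor_hom :: "('g::finite + 'g) tensor_alg \<Rightarrow> 'g H1 \<Rightarrow> ('g + 'g) tensor_alg"
  where "tensor_hom u Y = (\<Sum>x\<in>UNIV. tscale (pairing Y (axis x 1)) (left_quotient x u))"

lemma tensor_hom_incl_mult:
  fixes X Y :: "'g::finite H1"
  shows "tensor_hom (incl X * u) Y = tscale (pairing Y X) u"
proof -
  have lq: "left_quotient x (incl X * u) = tscale (X $ x) u" for x
    by (rule tensor_eqI) (simp add: left_quotient_def tscale_def tcoeff_incl_mult)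
  have split: "sum f UNIV = (\<Sum>i\<in>UNIV. f (Inl i)) + (\<Sum>i\<in>UNIV. f (Inr i))"
    for f :: "'g + 'g \<Rightarrow> rat"
    using sum.Plus[of "UNIV :: 'g set" "UNIV :: 'g set" f] by (simp add: comp_def)
  have inl: "pairing Y (axis (Inl i) 1) = - Y $ Inr i" for i
    by (simp add: pairing_def axis_def sum_negf if_distrib[of "\<lambda>x. _ * x"] cong: if_cong)
  have inr: "pairing Y (axis (Inr i) 1) = Y $ Inl i" for i
    by (simp add: pairing_def axis_def if_distrib[of "\<lambda>x. _ * x"] cong: if_cong)
  have "(\<Sum>x\<in>UNIV. pairing Y (axis x 1) * X $ x) = pairing Y X"
    unfolding split inl inr by (simp add: pairing_def sum_subtractf sum_negf)
  then show ?thesis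
    unfolding tensor_hom_def lq tens.scale_scale by (metis tens.scale_sum_left)
qed

text \<open>The elements of \<open>filt 1\<close> that correspond to the derivations in a given set.\<close>

definition tensors_of :: "(('g::finite + 'g) tensor_alg \<Rightarrow> ('g + 'g) tensor_alg) set \<Rightarrow> ('g + 'g) tensor_alg set"
  where "tensors_of S = {u \<in> filt 1. \<exists>D\<in>S. \<forall>Y. D (incl Y) = tensor_hom u Y}"

section \<open>Sums of families of subspaces\<close>

definition subspace_sum :: "'i set \<Rightarrow> ('i \<Rightarrow> 'a tensor_alg set) \<Rightarrow> 'a tensor_alg set"
  where "subspace_sum I V = tens.span (\<Union>i\<in>I. V i)"

definition sum_is_direct :: "'i set \<Rightarrow> ('i \<Rightarrow> 'a tensor_alg set) \<Rightarrow> bool"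
  where "sum_is_direct I V \<longleftrightarrow>
    (\<forall>F v. finite F \<and> F \<subseteq> I \<and> (\<forall>i\<in>F. v i \<in> V i) \<and> (\<Sum>i\<in>F. v i) = 0 \<longrightarrow> (\<forall>i\<in>F. v i = 0))"

end

theory Submission
  imports Defs
begin

text \<open>
  The element \<open>N(\<omega>\<^sup>k)\<close> corresponds to a multiple of the inner derivation of \<open>\<omega>\<^sup>k\<^sup>-\<^sup>1\<close>, which commutes
  with every derivation killing \<open>\<omega>\<close>. Conversely, let \<open>u\<close> be central. It is invariant under cyclic
  rotation, and commuting with the derivation of \<open>N(a\<^sup>* p q)\<close>, where \<open>a\<^sup>*\<close> is the symplectic partner
  of the basis letter \<open>a\<close> and \<open>p\<close>, \<open>q\<close> are letters with fresh indices, shows that the coefficient of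
  a cyclic word at a chosen letter \<open>a\<close> is, up to signs, the sum of the coefficients in which
  \<open>a\<close> and an adjacent \<open>a\<^sup>*\<close> are replaced by a fresh pair. In degree less than \<open>2m(g)\<close> there are
  enough indices to iterate this until the word consists of adjacent pairs with distinct indices.
  The coefficients of those words all agree up to sign, so in each degree \<open>2k\<close> one rational
  number determines \<open>u\<close>, and for \<open>k \<ge> 2\<close> it can be matched by a multiple of \<open>N(\<omega>\<^sup>k)\<close>; for \<open>k = 1\<close>
  both neighbours of a letter are its partner, and the signs force the number to vanish.
\<close>

section \<open>Coefficients, letters and quotients\<close>

lemma tcoeff_simps [simp]:
  "tcoeff (u + v) w = tcoeff u w + tcoeff v w"
  "tcoeff (u - v) w = tcoeff u w - tcoeff v w"
  "tcoeff (- u) w = - tcoeff u w"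
  "tcoeff 0 w = 0"
  "tcoeff 1 w = (if w = [] then 1 else 0)"
  "tcoeff (tscale r u) w = r * tcoeff u w"
  "tcoeff (left_quotient x u) w = tcoeff u (x # w)"
  by (simp_all add: plus_tensor_alg_def minus_tensor_alg_def uminus_tensor_alg_def
      zero_tensor_alg_def one_tensor_alg_def tscale_def left_quotient_def)

lemma tcoeff_sum [simp]: "tcoeff (\<Sum>i\<in>I. f i) w = (\<Sum>i\<in>I. tcoeff (f i) w)"
  by (induction I rule: infinite_finite_induct) auto

lemma tscale_mult_left [simp]: "tscale r u * v = tscale r (u * v)"
  by (rule tensor_eqI) (simp add: times_tensor_alg_def sum_distrib_left mult.assoc)

lemma tscale_mult_right [simp]: "u * tscale r v = tscale r (u * v)"
  by (rule tensor_eqI) (simp add: times_tensor_alg_def sum_distrib_left algebra_simps)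

lemma left_quotient_add [simp]: "left_quotient x (u + v) = left_quotient x u + left_quotient x v"
  and left_quotient_0 [simp]: "left_quotient x 0 = 0"
  and left_quotient_scale [simp]: "left_quotient x (tscale r u) = tscale r (left_quotient x u)"
  and left_quotient_minus [simp]: "left_quotient x (- u) = - left_quotient x u"
  and left_quotient_1 [simp]: "left_quotient x 1 = 0"
  by (rule tensor_eqI, simp)+

lemma left_quotient_sum [simp]: "left_quotient x (\<Sum>i\<in>I. f i) = (\<Sum>i\<in>I. left_quotient x (f i))"
  by (rule tensor_eqI) simp

lemma left_quotient_mult:
  "left_quotient x (u * v) = tscale (tcoeff u []) (left_quotient x v) + left_quotient x u * v"
  by (rule tensor_eqI) (simp add: tcoeff_mult_Cons)

definition letter :: "'a::finite \<Rightarrow> 'a tensor_alg"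
  where "letter x = incl (axis x 1)"

lemma tcoeff_letter_mult [simp]:
  "tcoeff (letter x * u) [] = 0"
  "tcoeff (letter x * u) (y # w) = (if y = x then tcoeff u w else 0)"
  by (auto simp: letter_def tcoeff_incl_mult axis_def)

lemma tcoeff_letter [simp]: "tcoeff (letter x) w = (if w = [x] then 1 else 0)"
  by (auto simp: letter_def incl_def axis_def split: list.splits)

lemma tcoeff_letter_letter: "tcoeff (letter x * letter y) w = (if w = [x, y] then 1 else 0)"
  by (cases w) auto

lemma left_quotient_letter_mult [simp]:
  "left_quotient y (letter x * u) = (if y = x then u else 0)"
  by (rule tensor_eqI) simp

lemma left_quotient_letter [simp]: "left_quotient y (letter x) = (if y = x then 1 else 0)"
  by (rule tensor_eqI) simp

lemma incl_eq_sum_letters: "incl X = (\<Sum>x\<in>UNIV. tscale (X $ x) (letter x))"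
proof (rule tensor_eqI)
  fix w
  show "tcoeff (incl X) w = tcoeff (\<Sum>x\<in>UNIV. tscale (X $ x) (letter x)) w"
    by (cases w rule: list.exhaust; cases "tl w")
      (auto simp: incl_def if_distrib[of "\<lambda>x. _ * x"] cong: if_cong)
qed

lemma sum_letter_left_quotient:
  fixes u :: "'a::finite tensor_alg"
  assumes "u \<in> filt 1"
  shows "(\<Sum>x\<in>UNIV. letter x * left_quotient x u) = u"
proof (rule tensor_eqI)
  fix w
  show "tcoeff (\<Sum>x\<in>UNIV. letter x * left_quotient x u) w = tcoeff u w"
    using assms by (cases w) (auto simp: filt_def)
qed

section \<open>Cyclic rotation\<close>

lemma tcoeff_nu_rotate1 [simp]: "tcoeff (nu u) (rotate1 w) = tcoeff u w"
  by (simp add: nu_def inv_f_f[OF inj_rotate1])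

lemma nu_eqI: "(\<And>w. tcoeff u w = tcoeff v (rotate1 w)) \<Longrightarrow> nu u = v"
  by (rule tensor_eqI) (metis surj_rotate1 surj_def tcoeff_nu_rotate1)

lemma nu_linear [simp]:
  "nu (u + v) = nu u + nu v"
  "nu (tscale r u) = tscale r (nu u)"
  "nu (\<Sum>i\<in>I. f i) = (\<Sum>i\<in>I. nu (f i))"
  by (rule nu_eqI; simp)+

lemma nu_letter_mult [simp]: "nu (letter x * u) = u * letter x"
  by (simp add: letter_def nu_incl_mult)

lemma tcoeff_mult_letter [simp]:
  "tcoeff (u * letter x) [] = 0"
  "tcoeff (u * letter x) (w @ [y]) = (if y = x then tcoeff u w else 0)"
proof -
  have "tcoeff (nu (letter x * u)) (rotate1 (y # w)) = (if y = x then tcoeff u w else 0)"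
    by (simp only: tcoeff_nu_rotate1 tcoeff_letter_mult)
  then show "tcoeff (u * letter x) (w @ [y]) = (if y = x then tcoeff u w else 0)"
    by simp
qed (simp add: tcoeff_mult_Nil)

lemma nu_fixed_swap:
  assumes "nu u = u"
  shows "tcoeff u (xs @ ys) = tcoeff u (ys @ xs)"
proof -
  have "tcoeff u (rotate n w) = tcoeff u w" for n w
    by (induction n) (simp, metis assms rotate_Suc tcoeff_nu_rotate1)
  from this[of "length xs" "xs @ ys"] show ?thesis
    by (simp add: rotate_append)
qed

lemma cyc_N_linear [simp]:
  "cyc_N (u + v) = cyc_N u + cyc_N v"
  "cyc_N (tscale r u) = tscale r (cyc_N u)"
proof -
  have "(nu ^^ k) (u + v) = (nu ^^ k) u + (nu ^^ k) v" for k
    by (induction k) auto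
  then show "cyc_N (u + v) = cyc_N u + cyc_N v"
    by (intro tensor_eqI) (simp add: cyc_N_def sum.distrib)
  have "(nu ^^ k) (tscale r u) = tscale r ((nu ^^ k) u)" for k
    by (induction k) auto
  then show "cyc_N (tscale r u) = tscale r (cyc_N u)"
    by (intro tensor_eqI) (simp add: cyc_N_def sum_distrib_left)
qed

text \<open>In degree n the map N multiplies a rotation-invariant tensor by n, so dividing each
  component by its degree gives a preimage. Degree 0, where N is zero, is excluded by
  \<open>p \<ge> 1\<close>.\<close>

lemma nu_fixed_in_cyc_N_filt:
  assumes "nu u = u" "u \<in> filt p" "p \<ge> 1"
  shows "u \<in> cyc_N ` filt p"
proof
  let ?t = "Tensor (\<lambda>w. tcoeff u w / of_nat (length w))"
  show "?t \<in> filt p"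
    using assms by (simp add: filt_def)
  have "nu ?t = ?t"
    by (rule nu_eqI) (use assms(1) in \<open>metis length_rotate1 tcoeff_Tensor tcoeff_nu_rotate1\<close>)
  then have "(nu ^^ k) ?t = ?t" for k
    by (induction k) auto
  then show "u = cyc_N ?t"
    using assms(2,3) by (intro tensor_eqI) (auto simp: cyc_N_def filt_def)
qed

section \<open>The symplectic element in terms of letters\<close>

text \<open>\<open>bar\<close> is the symplectic partner of a basis letter, \<open>sg x\<close> is
  the pairing of \<open>x\<close> with \<open>bar x\<close>, and \<open>idx\<close> forgets which
  letter of the pair is meant.\<close>

primrec bar :: "'a + 'a \<Rightarrow> 'a + 'a" where
  "bar (Inl i) = Inr i"
| "bar (Inr i) = Inl i"

primrec sg :: "'a + 'a \<Rightarrow> rat" where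
  "sg (Inl i) = 1"
| "sg (Inr i) = -1"

primrec idx :: "'a + 'a \<Rightarrow> 'a" where
  "idx (Inl i) = i"
| "idx (Inr i) = i"

lemma bar_bar [simp]: "bar (bar x) = x"
  and idx_bar [simp]: "idx (bar x) = idx x"
  and sg_bar [simp]: "sg (bar x) = - sg x"
  and sg_sg [simp]: "sg x * sg x = 1"
  and sg_nonzero [simp]: "sg x \<noteq> 0"
  and bar_neq [simp]: "bar x \<noteq> x"
  by (cases x; simp)+

lemma sg_sg_mult [simp]: "sg x * (sg x * r) = r"
  by (simp flip: mult.assoc)

lemma bar_eq_iff: "bar x = y \<longleftrightarrow> x = bar y"
  by auto

lemma sum_bar: "(\<Sum>x\<in>UNIV. f (bar x)) = (\<Sum>x\<in>UNIV. f x)"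
  by (rule sum.reindex_bij_witness[of _ bar bar]) auto

lemma sum_Plus_UNIV:
  fixes f :: "'a::finite + 'b::finite \<Rightarrow> 'c::comm_monoid_add"
  shows "(\<Sum>x\<in>UNIV. f x) = (\<Sum>i\<in>UNIV. f (Inl i)) + (\<Sum>i\<in>UNIV. f (Inr i))"
  using sum.Plus[of "UNIV :: 'a set" "UNIV :: 'b set" f] by (simp add: comp_def)

lemma omega_eq: "omega = (\<Sum>x\<in>UNIV. tscale (sg x) (letter x * letter (bar x)))"
  by (simp add: sum_Plus_UNIV omega_def letter_def basisA_def basisB_def sum_subtractf
      flip: sum.distrib)

lemma tcoeff_omega_mult:
  "tcoeff (omega * u) [] = 0"
  "tcoeff (omega * u) [x] = 0"
  "tcoeff (omega * u) (x # y # w) = (if y = bar x then sg x * tcoeff u w else 0)"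
  by (auto simp: omega_eq sum_distrib_right mult.assoc if_distrib[of "\<lambda>x. _ * x"] cong: if_cong)

lemma left_quotient_omega_mult:
  "left_quotient x (omega * u) = tscale (sg x) (letter (bar x) * u)"
  by (simp add: omega_eq sum_distrib_right mult.assoc if_distrib[of "tscale _"] cong: if_cong)

lemma nu_omega_mult: "nu (omega * u) = (\<Sum>x\<in>UNIV. tscale (sg x) (letter (bar x) * u * letter x))"
  by (simp add: omega_eq sum_distrib_right mult.assoc)

text \<open>With \<open>left_quotient_omega_mult\<close> this identifies the derivation of
  \<open>omega * u + nu (omega * u)\<close> as \<open>x \<mapsto> u * x - x * u\<close> on
  letters.\<close>

lemma left_quotient_nu_omega_mult:
  "left_quotient x (nu (omega * u)) = - tscale (sg x) (u * letter (bar x))"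
proof -
  have "left_quotient x (nu (omega * u)) =
      (\<Sum>y\<in>UNIV. left_quotient x (tscale (sg (bar y)) (letter (bar (bar y)) * u * letter (bar y))))"
    by (simp only: nu_omega_mult left_quotient_sum) (rule sum_bar[symmetric])
  also have "\<dots> = (\<Sum>y\<in>UNIV. if x = y then - tscale (sg x) (u * letter (bar x)) else 0)"
    by (rule sum.cong) (auto simp: mult.assoc)
  finally show ?thesis
    by simp
qed

lemma nu_nu_omega_mult: "nu (nu (omega * u)) = u * omega"
  by (simp add: nu_omega_mult mult.assoc)
    (simp add: omega_eq sum_distrib_left mult.assoc)

lemma tcoeff_omega_power_eq_0: "length w \<noteq> 2 * k \<Longrightarrow> tcoeff (omega ^ k) w = 0"
proof (induction k arbitrary: w)
  case (Suc k)
  then show ?case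
    by (cases w rule: remdups_adj.cases) (auto simp: tcoeff_omega_mult)
qed auto

lemma nu_nu_omega_power: "nu (nu (omega ^ k)) = omega ^ k"
proof (cases k)
  case 0
  have "nu 1 = (1 :: ('a + 'a) tensor_alg)"
    by (rule nu_eqI) simp
  with 0 show ?thesis
    by simp
next
  case (Suc j)
  then show ?thesis
    by (simp add: nu_nu_omega_mult) (simp add: power_commutes)
qed

text \<open>Two rotations carry a leading \<open>omega\<close> to the end, so rotation has period
  two on \<open>omega ^ k\<close>, and the 2k summands of N alternate between two values. In all
  other degrees both sides vanish.\<close>

lemma cyc_N_omega_power: "cyc_N (omega ^ k) = tscale (of_nat k) (omega ^ k + nu (omega ^ k))"
proof (rule tensor_eqI)
  fix w :: "('a + 'a) list"
  let ?s = "omega ^ k :: ('a + 'a) tensor_alg"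
  have even: "(nu ^^ (2 * j)) ?s = ?s" for j
    by (induction j) (auto simp: nu_nu_omega_power)
  then have odd: "(nu ^^ (2 * j + 1)) ?s = nu ?s" for j
    by (metis Suc_eq_plus1 comp_apply funpow.simps(2))
  show "tcoeff (cyc_N ?s) w = tcoeff (tscale (of_nat k) (?s + nu ?s)) w"
  proof (cases "length w = 2 * k")
    case True
    have "(\<Sum>j<2 * i. tcoeff ((nu ^^ j) ?s) w) = of_nat i * tcoeff (?s + nu ?s) w" for i
    proof (induction i)
      case (Suc i)
      then show ?case
        using even[of i] odd[of i] by (simp add: algebra_simps)
    qed simp
    from this[of k] show ?thesis
      by (simp add: cyc_N_def True)
  next
    case False
    have z: "length v = length w \<Longrightarrow> tcoeff ((nu ^^ j) ?s) v = 0" for j v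
    proof (induction j arbitrary: v)
      case (Suc j)
      obtain v' where "v = rotate1 v'"
        using surj_rotate1 by blast
      with Suc show ?case
        by simp
    qed (use False in \<open>simp add: tcoeff_omega_power_eq_0\<close>)
    show ?thesis
      using z[of w 0] z[of w 1] z[of w] by (simp add: cyc_N_def)
  qed
qed

section \<open>Derivations and their values on letters\<close>

lemma tensor_hom_axis: "tensor_hom u (axis x 1) = tscale (sg x) (left_quotient (bar x) u)"
  and tensor_hom_eq_sum:
    "tensor_hom u Y = (\<Sum>x\<in>UNIV. tscale (Y $ x) (tensor_hom u (axis x 1)))"
proof -
  have pair: "pairing Y (axis x 1) = - sg x * Y $ bar x" for Y :: "'a H1" and x
    by (cases x) (simp_all add: pairing_def axis_def sum_negf if_distrib[of "\<lambda>x. _ * x"] cong: if_cong)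
  have "tensor_hom u Y = (\<Sum>x\<in>UNIV. tscale (- sg (bar x) * Y $ bar (bar x)) (left_quotient (bar x) u))"
    for Y
    by (simp only: tensor_hom_def pair sum_bar[of "\<lambda>x. tscale (- sg x * Y $ bar x) (left_quotient x u)"])
  then have eq: "tensor_hom u Y = (\<Sum>x\<in>UNIV. tscale (sg x * Y $ x) (left_quotient (bar x) u))" for Y
    by simp
  have "tensor_hom u (axis x 1) =
      (\<Sum>y\<in>UNIV. if x = y then tscale (sg x) (left_quotient (bar x) u) else 0)" for x
    unfolding eq by (rule sum.cong) (auto simp: axis_def)
  then show ax: "tensor_hom u (axis x 1) = tscale (sg x) (left_quotient (bar x) u)" for x
    by simp
  show "tensor_hom u Y = (\<Sum>x\<in>UNIV. tscale (Y $ x) (tensor_hom u (axis x 1)))"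
    unfolding ax unfolding eq by (simp add: mult.commute)
qed

lemma derivation_linear:
  assumes "derivation D"
  shows "D (u + v) = D u + D v" "D (tscale r u) = tscale r (D u)" "D 0 = 0" "D (u - v) = D u - D v"
    "D (\<Sum>i\<in>I. f i) = (\<Sum>i\<in>I. D (f i))"
proof -
  interpret Vector_Spaces.linear tscale tscale D
    using assms by (simp add: derivation_def)
  show "D (u + v) = D u + D v" "D (tscale r u) = tscale r (D u)" "D 0 = 0" "D (u - v) = D u - D v"
    "D (\<Sum>i\<in>I. f i) = (\<Sum>i\<in>I. D (f i))"
    by (rule add scale zero diff sum)+
qed

lemma derivation_mult: "derivation D \<Longrightarrow> D (u * v) = D u * v + u * D v"
  by (simp add: derivation_def)

lemma derivationI:
  assumes "\<And>u v. D (u + v) = D u + D v" "\<And>r u. D (tscale r u) = tscale r (D u)"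
    "\<And>u v. D (u * v) = D u * v + u * D v"
  shows "derivation D"
  unfolding derivation_def
  by (auto intro!: Vector_Spaces.linear.intro tens.vector_space_axioms
      module_hom.intro module_hom_axioms.intro tens.module_axioms assms
      simp: Vector_Spaces.linear_iff)

text \<open>The identification of tensors with derivations, tested on basis letters only;
  \<open>represents_iff\<close> extends it to all of H.\<close>

definition represents :: "('g::finite + 'g) tensor_alg \<Rightarrow> (('g + 'g) tensor_alg \<Rightarrow> ('g + 'g) tensor_alg) \<Rightarrow> bool"
  where "represents u D \<longleftrightarrow>
    u \<in> filt 1 \<and> derivation D \<and> (\<forall>x. D (letter x) = tscale (sg x) (left_quotient (bar x) u))"

lemma represents_iff:
  "represents u D \<longleftrightarrow> u \<in> filt 1 \<and> derivation D \<and> (\<forall>Y. D (incl Y) = tensor_hom u Y)"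
proof -
  have "(\<forall>x. D (letter x) = tscale (sg x) (left_quotient (bar x) u)) \<longleftrightarrow>
      (\<forall>Y. D (incl Y) = tensor_hom u Y)" if "derivation D"
  proof (intro iffI allI)
    fix Y
    assume "\<forall>x. D (letter x) = tscale (sg x) (left_quotient (bar x) u)"
    then show "D (incl Y) = tensor_hom u Y"
      by (simp add: tensor_hom_eq_sum[of u Y] incl_eq_sum_letters derivation_linear[OF that]
          tensor_hom_axis)
  next
    fix x
    assume "\<forall>Y. D (incl Y) = tensor_hom u Y"
    then show "D (letter x) = tscale (sg x) (left_quotient (bar x) u)"
      by (simp add: letter_def tensor_hom_axis)
  qed
  then show ?thesis
    by (auto simp: represents_def)
qed

lemma tensors_of_iff:
  assumes "S \<subseteq> Der_omega"
  shows "u \<in> tensors_of S \<longleftrightarrow> (\<exists>D\<in>S. represents u D)"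
  using assms by (auto simp: tensors_of_def represents_iff Der_omega_def)

text \<open>Differentiating the first letters of \<open>omega\<close> produces the rotation of
  \<open>u\<close>, differentiating the second ones produces \<open>- u\<close>. Hence killing
  \<open>omega\<close> amounts to cyclic invariance.\<close>

lemma represents_omega:
  assumes "represents u D"
  shows "D omega = nu u - u"
proof -
  have D: "derivation D" "u \<in> filt 1" "\<And>x. D (letter x) = tscale (sg x) (left_quotient (bar x) u)"
    using assms by (auto simp: represents_def)
  have "D omega = (\<Sum>x\<in>UNIV. left_quotient (bar x) u * letter (bar x) - letter x * left_quotient x u)"
    by (simp add: omega_eq derivation_linear[OF D(1)] derivation_mult[OF D(1)] D(3)
        tens.scale_right_diff_distrib)
  also have "\<dots> = (\<Sum>x\<in>UNIV. left_quotient x u * letter x) - (\<Sum>x\<in>UNIV. letter x * left_quotient x u)"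
    by (simp add: sum_subtractf sum_bar[of "\<lambda>x. left_quotient x u * letter x"])
  also have "(\<Sum>x\<in>UNIV. left_quotient x u * letter x) = nu (\<Sum>x\<in>UNIV. letter x * left_quotient x u)"
    by simp
  finally show ?thesis
    by (simp only: sum_letter_left_quotient[OF D(2)])
qed

lemma represents_add:
  "represents u D \<Longrightarrow> represents v E \<Longrightarrow> represents (u + v) (\<lambda>t. D t + E t)"
  unfolding represents_def
  by (auto intro!: derivationI
      simp: derivation_linear derivation_mult filt_def algebra_simps tens.scale_right_distrib)

lemma represents_scale: "represents u D \<Longrightarrow> represents (tscale r u) (\<lambda>t. tscale r (D t))"
  unfolding represents_def
  by (auto intro!: derivationI simp: derivation_linear derivation_mult filt_def
      tens.scale_right_distrib tens.scale_left_commute)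

lemma represents_0: "represents 0 (\<lambda>t. 0)"
  unfolding represents_def by (auto intro!: derivationI simp: filt_def)

text \<open>The derivation \<open>D\<close> with \<open>D x = f x\<close> on letters satisfies
  \<open>D u = (\<Sum>x. f x * left_quotient x u + x * D (left_quotient x u))\<close>, which determines its coefficients
  by recursion on the word.\<close>

primrec ext_coeff :: "('a::finite \<Rightarrow> 'a tensor_alg) \<Rightarrow> 'a list \<Rightarrow> 'a tensor_alg \<Rightarrow> rat" where
  "ext_coeff f [] u = (\<Sum>x\<in>UNIV. tcoeff (f x * left_quotient x u) [])"
| "ext_coeff f (y # w) u =
    (\<Sum>x\<in>UNIV. tcoeff (f x * left_quotient x u) (y # w)) + ext_coeff f w (left_quotient y u)"

definition ext_der :: "('a::finite \<Rightarrow> 'a tensor_alg) \<Rightarrow> 'a tensor_alg \<Rightarrow> 'a tensor_alg"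
  where "ext_der f u = Tensor (\<lambda>w. ext_coeff f w u)"

lemma ext_coeff_linear:
  "ext_coeff f w (u + v) = ext_coeff f w u + ext_coeff f w v"
  "ext_coeff f w (tscale r u) = r * ext_coeff f w u"
  by (induction w arbitrary: u v)
    (simp_all add: distrib_left sum.distrib sum_distrib_left)

lemma ext_coeff_0 [simp]: "ext_coeff f w 0 = 0"
  using ext_coeff_linear(2)[of f w 0 0] by simp

lemma ext_der_0 [simp]: "ext_der f 0 = 0"
  by (rule tensor_eqI) (simp add: ext_der_def)

lemma ext_der_eq:
  "ext_der f u =
    (\<Sum>x\<in>UNIV. f x * left_quotient x u) + (\<Sum>x\<in>UNIV. letter x * ext_der f (left_quotient x u))"
proof (rule tensor_eqI)
  fix w
  show "tcoeff (ext_der f u) w = tcoeff ((\<Sum>x\<in>UNIV. f x * left_quotient x u) +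
      (\<Sum>x\<in>UNIV. letter x * ext_der f (left_quotient x u))) w"
    by (cases w) (simp_all add: ext_der_def)
qed

text \<open>The Leibniz rule, by induction on the word: the recursion strips the first letter and
  passes to left quotients, and \<open>left_quotient_mult\<close> matches the resulting
  terms.\<close>

lemma tcoeff_ext_der_mult:
  "tcoeff (ext_der f (u * v)) w = tcoeff (ext_der f u * v + u * ext_der f v) w"
proof (induction w arbitrary: u)
  case Nil
  show ?case
    by (simp add: ext_der_def tcoeff_mult_Nil left_quotient_mult distrib_left sum.distrib
        sum_distrib_left sum_distrib_right algebra_simps)
next
  case (Cons y w)
  let ?F = "\<lambda>u. \<Sum>x\<in>UNIV. f x * left_quotient x u"
  \<comment> \<open>The terms in which the first letter is differentiated; the constant term of
    \<open>u\<close> lets the first letter of a product come from \<open>v\<close>.\<close>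
  have F: "?F (u * v) = tscale (tcoeff u []) (?F v) + ?F u * v"
    by (simp add: left_quotient_mult distrib_left sum.distrib sum_distrib_right mult.assoc
        tens.scale_sum_right)
  have rec: "tcoeff (ext_der f t) (y # w) = tcoeff (?F t) (y # w) + tcoeff (ext_der f (left_quotient y t)) w"
    for t
    by (simp add: ext_der_def)
  have "tcoeff (ext_der f (u * v)) (y # w) =
      tcoeff u [] * tcoeff (ext_der f v) (y # w) + tcoeff (?F u * v) (y # w) +
      tcoeff (ext_der f (left_quotient y u) * v + left_quotient y u * ext_der f v) w"
    unfolding rec F Cons.IH[symmetric]
    by (simp add: left_quotient_mult) (simp add: ext_der_def ext_coeff_linear algebra_simps)
  moreover have "tcoeff (ext_der f u * v) (y # w) =
      tcoeff (?F u * v) (y # w) + tcoeff (ext_der f (left_quotient y u) * v) w"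
    by (subst ext_der_eq) (simp add: distrib_right sum_distrib_right mult.assoc)
  moreover have "tcoeff (u * ext_der f v) (y # w) =
      tcoeff u [] * tcoeff (ext_der f v) (y # w) + tcoeff (left_quotient y u * ext_der f v) w"
    by (rule tcoeff_mult_Cons)
  ultimately show ?case
    by simp
qed

lemma derivation_ext_der: "derivation (ext_der f)"
proof (rule derivationI)
  show "ext_der f (u * v) = ext_der f u * v + u * ext_der f v" for u v
    by (rule tensor_eqI) (rule tcoeff_ext_der_mult)
qed (auto intro!: tensor_eqI simp: ext_der_def ext_coeff_linear)

lemma ext_der_letter: "ext_der f (letter x) = f x"
proof -
  have 1: "ext_der f 1 = 0"
    by (subst ext_der_eq) simp
  have "f y * left_quotient y (letter x) = (if y = x then f x else 0)"
    "letter y * ext_der f (left_quotient y (letter x)) = 0" for y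
    using 1 by auto
  then show ?thesis
    by (subst ext_der_eq) simp
qed

text \<open>Left quotients do not see the constant term of \<open>v\<close>, so this is the
  derivation belonging to \<open>v\<close> only when that term is zero.\<close>

definition tder :: "('g::finite + 'g) tensor_alg \<Rightarrow> ('g + 'g) tensor_alg \<Rightarrow> ('g + 'g) tensor_alg"
  where "tder v = ext_der (\<lambda>x. tscale (sg x) (left_quotient (bar x) v))"

lemma represents_tder: "v \<in> filt 1 \<Longrightarrow> represents v (tder v)"
  by (simp add: represents_def tder_def derivation_ext_der ext_der_letter)

lemma tder_in_Der_omega:
  assumes "v \<in> filt 1" "nu v = v"
  shows "tder v \<in> Der_omega"
  using represents_tder[OF assms(1)] represents_omega[OF represents_tder[OF assms(1)]] assms(2)
  by (simp add: Der_omega_def represents_def)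

section \<open>The powers of the symplectic element are central\<close>

lemma Der_omega_linear:
  assumes "D \<in> Der_omega" "E \<in> Der_omega"
  shows "(\<lambda>t. D t + E t) \<in> Der_omega" "(\<lambda>t. tscale r (D t)) \<in> Der_omega"
  using assms unfolding Der_omega_def
  by (auto intro!: derivationI simp: derivation_linear derivation_mult algebra_simps
      tens.scale_right_distrib tens.scale_left_commute)

lemma subspace_tensors_of_center: "tens.subspace (tensors_of (lie_center Der_omega))"
proof -
  have iff: "u \<in> tensors_of (lie_center Der_omega) \<longleftrightarrow>
      (\<exists>D\<in>lie_center Der_omega. represents u D)" for u :: "('g::finite + 'g) tensor_alg"
    by (rule tensors_of_iff) (auto simp: lie_center_def)
  have center: "D \<in> lie_center Der_omega \<longleftrightarrow>
      D \<in> Der_omega \<and> (\<forall>E\<in>Der_omega. \<forall>t. D (E t) = E (D t))" for D :: "('g::finite + 'g) tensor_alg \<Rightarrow> _"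
    by (auto simp: lie_center_def commutator_def fun_eq_iff)
  have lin: "E (s + t) = E s + E t" "E (tscale r s) = tscale r (E s)" "E 0 = 0"
    if "E \<in> Der_omega" for E :: "('g::finite + 'g) tensor_alg \<Rightarrow> _" and s t r
    using that by (auto simp: Der_omega_def derivation_linear)
  show ?thesis
  proof (rule tens.subspaceI)
    have "(\<lambda>t. 0) \<in> lie_center (Der_omega :: (('g::finite + 'g) tensor_alg \<Rightarrow> _) set)"
      by (auto simp: center lin) (auto simp: Der_omega_def intro: derivationI)
    then show "0 \<in> tensors_of (lie_center (Der_omega :: (('g::finite + 'g) tensor_alg \<Rightarrow> _) set))"
      using represents_0 iff by blast
  next
    fix u v :: "('g::finite + 'g) tensor_alg"
    assume "u \<in> tensors_of (lie_center Der_omega)" "v \<in> tensors_of (lie_center Der_omega)"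
    then obtain D E where "D \<in> lie_center Der_omega" "represents u D"
      "E \<in> lie_center Der_omega" "represents v E"
      using iff by blast
    then show "u + v \<in> tensors_of (lie_center Der_omega)"
      unfolding iff
      by (intro bexI[of _ "\<lambda>t. D t + E t"]) (auto simp: represents_add center lin Der_omega_linear)
  next
    fix r and u :: "('g::finite + 'g) tensor_alg"
    assume "u \<in> tensors_of (lie_center Der_omega)"
    then obtain D where "D \<in> lie_center Der_omega" "represents u D"
      using iff by blast
    then show "tscale r u \<in> tensors_of (lie_center Der_omega)"
      unfolding iff
      by (intro bexI[of _ "\<lambda>t. tscale r (D t)"]) (auto simp: represents_scale center lin Der_omega_linear)
  qed
qed

lemma omega_power_derivation:
  assumes "E \<in> Der_omega"
  shows "E (omega ^ k) = 0"
proof (induction k)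
  case 0
  have "E (1 * 1) = E 1 + E 1"
    using assms derivation_mult[of E 1 1] by (simp add: Der_omega_def)
  then show ?case
    by simp
next
  case (Suc k)
  then show ?case
    using assms by (simp add: Der_omega_def derivation_mult)
qed

text \<open>The tensor \<open>N(\<omega>\<^sup>k)\<close> corresponds to the inner derivation \<open>k [\<omega>\<^sup>k\<^sup>-\<^sup>1, _]\<close>.\<close>

lemma cyc_N_omega_power_central:
  assumes "k \<ge> 1"
  shows "cyc_N (omega ^ k) \<in> tensors_of (lie_center (Der_omega :: (('g::finite + 'g) tensor_alg \<Rightarrow> _) set))"
proof -
  obtain j where k: "k = Suc j"
    using assms by (cases k) auto
  define p where "p = (omega ^ j :: ('g + 'g) tensor_alg)"
  define D where "D = (\<lambda>t. p * t - t * p)"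
  have "derivation D"
    by (rule derivationI) (simp_all add: D_def algebra_simps tens.scale_right_diff_distrib)
  moreover have "D omega = 0"
    by (simp add: D_def p_def power_commutes)
  ultimately have Der: "D \<in> Der_omega"
    by (simp add: Der_omega_def)
  \<comment> \<open>\<open>E\<close> kills \<open>p\<close>, a power of \<open>omega\<close>, so the
    Leibniz rule makes it commute with the bracket with \<open>p\<close>.\<close>
  have "D (E t) = E (D t)" if "E \<in> Der_omega" for E t
    using that omega_power_derivation[OF that, of j]
    by (simp add: D_def p_def Der_omega_def derivation_linear derivation_mult)
  then have center: "D \<in> lie_center Der_omega"
    using Der by (auto simp: lie_center_def commutator_def fun_eq_iff)
  have "represents (omega * p + nu (omega * p)) D"
    unfolding represents_def
  proof (intro conjI allI)
    have "tcoeff (nu (omega * p)) [] = tcoeff (omega * p) []"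
      using tcoeff_nu_rotate1[of "omega * p" "[]"] by simp
    then show "omega * p + nu (omega * p) \<in> filt 1"
      by (simp add: filt_def tcoeff_omega_mult)
    show "derivation D"
      by fact
    show "D (letter x) = tscale (sg x) (left_quotient (bar x) (omega * p + nu (omega * p)))" for x
      by (simp add: left_quotient_omega_mult left_quotient_nu_omega_mult D_def tens.scale_right_distrib
         tens.scale_right_diff_distrib tens.scale_minus_left)
  qed
  with center have "omega * p + nu (omega * p) \<in> tensors_of (lie_center Der_omega)"
    by (subst tensors_of_iff) (auto simp: lie_center_def)
  then show ?thesis
    unfolding cyc_N_omega_power using tens.subspace_scale[OF subspace_tensors_of_center]
    by (simp add: k p_def)
qed

section \<open>Relations between the coefficients of a central element\<close>

lemma center_commutes:
  assumes "D \<in> lie_center L" "E \<in> L"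
  shows "D (E t) = E (D t)"
proof -
  have "commutator D E = (\<lambda>u. 0)"
    using assms by (simp add: lie_center_def)
  from fun_cong[OF this, of t] show ?thesis
    by (simp add: commutator_def)
qed

text \<open>Every word in the value of the derivation contains a word of some \<open>f x\<close> as
  a contiguous block, whose letters would then lie in \<open>w\<close>.\<close>

lemma ext_coeff_eq_0:
  assumes "\<And>x v. set v \<subseteq> set w \<Longrightarrow> tcoeff (f x) v = 0"
  shows "ext_coeff f w u = 0"
  using assms
proof (induction w arbitrary: u)
  case Nil
  then show ?case
    by (simp add: tcoeff_mult_Nil)
next
  case (Cons y w)
  have "tcoeff (f x * t) (y # w) = 0" for x t
    unfolding times_tensor_alg_def tcoeff_Tensor
    by (intro sum.neutral ballI) (simp add: Cons.prems set_take_subset del: set_simps)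
  moreover have "ext_coeff f w (left_quotient y u) = 0"
    by (rule Cons.IH) (use Cons.prems in auto)
  ultimately show ?case
    by simp
qed

text \<open>The derivation of the square of \<open>bar a\<close> sends \<open>a\<close> to a signed
  \<open>bar a\<close> and the other letters to 0, so its values have no constant term. Commuting
  with it forces the constant term of \<open>D (bar a)\<close>, a signed coefficient of
  \<open>[a]\<close>, to vanish.\<close>

lemma central_degree_1:
  assumes D: "D \<in> lie_center Der_omega" "represents u D"
  shows "tcoeff u [a] = 0"
proof -
  let ?v = "letter (bar a) * letter (bar a)"
  have v: "?v \<in> filt 1" "nu ?v = ?v"
    by (auto simp: filt_def)
  have E: "tder ?v \<in> Der_omega" "\<And>x. tder ?v (letter x) = tscale (sg x) (left_quotient (bar x) ?v)"
    using tder_in_Der_omega[OF v] represents_tder[OF v(1)] by (simp_all add: represents_def)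
  have Dl: "derivation D" "\<And>x. D (letter x) = tscale (sg x) (left_quotient (bar x) u)"
    using D(2) by (auto simp: represents_def)
  have "D (tder ?v (letter a)) = tder ?v (D (letter a))"
    by (rule center_commutes[OF D(1) E(1)])
  then have "tcoeff (D (tder ?v (letter a))) [] = tcoeff (tder ?v (D (letter a))) []"
    by simp
  moreover have "tcoeff (tder ?v t) [] = 0" for t
    by (simp add: tder_def ext_der_def tcoeff_mult_Nil if_distrib[of "\<lambda>x. tcoeff x _"]
        if_distrib[of "\<lambda>x. x * _"] cong: if_cong)
  moreover have "D (tder ?v (letter a)) = - left_quotient a u"
    unfolding E(2) by (simp add: derivation_linear[OF Dl(1)] Dl(2) tens.scale_minus_left)
  ultimately show ?thesis
    by simp
qed

text \<open>The test derivation corresponds to the cyclic word \<open>N((bar a) p q)\<close> and is evaluated on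
  \<open>bar p\<close>; comparing the coefficients of \<open>q # w\<close> isolates that of \<open>a # w\<close> because \<open>p\<close> and \<open>q\<close> do
  not occur in \<open>w\<close>.\<close>

lemma central_relation:
  assumes D: "D \<in> lie_center Der_omega" "represents u D"
    and neq: "p \<noteq> q" "p \<noteq> bar a" "q \<noteq> bar a" and fresh: "p \<notin> set w" "q \<notin> set w"
  shows "sg a * tcoeff u (a # w) =
    sg p * tcoeff (letter (bar a) * left_quotient (bar p) (left_quotient p u)) w +
    sg q * tcoeff (left_quotient (bar q) u * letter (bar a)) (q # w)"
proof -
  let ?a = "letter (bar a)"
  let ?v = "?a * letter p * letter q + letter p * letter q * ?a + letter q * ?a * letter p"
  let ?f = "\<lambda>x. tscale (sg x) (left_quotient (bar x) ?v)"
  let ?U = "left_quotient p u"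
  have v: "?v \<in> filt 1" "nu ?v = ?v"
    by (auto simp: filt_def mult.assoc)
  have E: "tder ?v \<in> Der_omega" "derivation (tder ?v)" "\<And>x. tder ?v (letter x) = ?f x"
    using tder_in_Der_omega[OF v] represents_tder[OF v(1)] unfolding represents_def by blast+
  have Dl: "derivation D" "\<And>x. D (letter x) = tscale (sg x) (left_quotient (bar x) u)"
    using D(2) by (auto simp: represents_def)
  \<comment> \<open>Only the rotation of the word starting with \<open>p\<close> contributes, since
    \<open>p\<close> differs from \<open>q\<close> and \<open>bar a\<close>.\<close>
  have "tder ?v (letter (bar p)) = tscale (- sg p) (letter q * ?a)"
    unfolding E(3) using neq by (simp add: mult.assoc)
  moreover have "D (tder ?v (letter (bar p))) = tder ?v (D (letter (bar p)))"
    by (rule center_commutes[OF D(1) E(1)])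
  moreover have "D (letter (bar p)) = tscale (- sg p) ?U"
    by (simp add: Dl(2))
  ultimately have "tscale (- sg p) (D (letter q) * ?a + letter q * D ?a) = tscale (- sg p) (tder ?v ?U)"
    by (simp only: derivation_linear[OF Dl(1)] derivation_linear[OF E(2)] derivation_mult[OF Dl(1)])
  then have "D (letter q) * ?a + letter q * D ?a = tder ?v ?U"
    by simp
  then have main: "tcoeff (D (letter q) * ?a) (q # w) + tcoeff (D ?a) w = tcoeff (tder ?v ?U) (q # w)"
    by (metis tcoeff_letter_mult(2) tcoeff_simps(1))
  \<comment> \<open>Each nonzero \<open>?f x\<close> is a signed two-letter word containing
    \<open>p\<close> or \<open>q\<close>, so it cannot occur inside \<open>w\<close>. At the front
    of \<open>q # w\<close> only \<open>q (bar a)\<close> fits, which arises from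
    \<open>x = bar p\<close>.\<close>
  have "ext_coeff ?f w t = 0" for t
    by (rule ext_coeff_eq_0) (use fresh in \<open>auto simp: mult.assoc tcoeff_letter_letter\<close>)
  moreover have "tcoeff (?f x * left_quotient x ?U) (q # w) =
      (if x = bar p then - sg p * tcoeff (?a * left_quotient (bar p) ?U) w else 0)" for x
    using neq by (auto simp: mult.assoc bar_eq_iff)
  ultimately have "tcoeff (tder ?v ?U) (q # w) = - sg p * tcoeff (?a * left_quotient (bar p) ?U) w"
    unfolding tder_def ext_der_def by simp
  with main show ?thesis
    by (simp add: Dl(2))
qed

lemma nu_fixed_of_Der_omega:
  assumes "D \<in> Der_omega" "represents u D"
  shows "nu u = u"
  using represents_omega[OF assms(2)] assms(1) by (simp add: Der_omega_def)

section \<open>Vanishing of the coefficients\<close>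

text \<open>These are the words occurring in the powers of \<open>omega\<close>.\<close>

primrec blk :: "('a + 'a) list \<Rightarrow> ('a + 'a) list" where
  "blk [] = []"
| "blk (x # xs) = x # bar x # blk xs"

lemma blk_append [simp]: "blk (xs @ ys) = blk xs @ blk ys"
  and length_blk [simp]: "length (blk xs) = 2 * length xs"
  and idx_set_blk [simp]: "idx ` set (blk xs) = idx ` set xs"
  and blk_eq_Nil_iff [simp]: "blk xs = [] \<longleftrightarrow> xs = []"
  by (induction xs) auto

lemma last_blk [simp]: "xs \<noteq> [] \<Longrightarrow> last (blk xs) = bar (last xs)"
  by (induction xs) auto

lemma hd_blk [simp]: "xs \<noteq> [] \<Longrightarrow> hd (blk xs) = hd xs"
  by (cases xs) auto

lemma obtain_fresh_letters:
  fixes S :: "'g::finite set"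
  assumes "card S + k \<le> CARD('g)"
  obtains zs :: "('g + 'g) list"
  where "length zs = k" "distinct (map idx zs)" "idx ` set zs \<inter> S = {}"
proof -
  have "k \<le> card (- S)"
    using assms by (simp add: Compl_eq_Diff_UNIV card_Diff_subset)
  then obtain T where T: "T \<subseteq> - S" "card T = k"
    by (metis obtain_subset_with_card_n)
  obtain js where "set js = T" "distinct js"
    using finite_distinct_list[of T] finite by blast
  with T have "length (map Inl js) = k" "distinct (map idx (map Inl js))"
    "idx ` set (map Inl js) \<inter> S = {}"
    by (auto simp: comp_def image_image distinct_card)
  then show ?thesis
    by (rule that)
qed

text \<open>Isolates what the combinatorics uses of a central element. In the cyclic word
  \<open>a # w\<close> the partner \<open>bar a\<close> may follow \<open>a\<close> (head of
  \<open>w\<close>) or precede it (last of \<open>w\<close>); in each case the adjacent pair is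
  replaced in place by a fresh one.\<close>

locale central_coeffs =
  fixes c :: "('g::finite + 'g) list \<Rightarrow> rat"
  assumes swap: "c (xs @ ys) = c (ys @ xs)"
    and rel: "\<lbrakk>idx p \<noteq> idx q; idx p \<notin> idx ` set (a # w); idx q \<notin> idx ` set (a # w)\<rbrakk> \<Longrightarrow>
      sg a * c (a # w) =
        (if w \<noteq> [] \<and> hd w = bar a then sg p * c (p # bar p # tl w) else 0) +
        (if w \<noteq> [] \<and> last w = bar a then sg q * c (bar q # q # butlast w) else 0)"
begin

lemma obtain_fresh_pair:
  fixes w :: "('g + 'g) list"
  assumes "length w + 2 \<le> CARD('g)"
  obtains p q where "idx p \<noteq> idx q" "idx p \<notin> idx ` set w" "idx q \<notin> idx ` set w"
proof -
  have "card (idx ` set w) + 2 \<le> CARD('g)"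
    using assms card_image_le[of "set w" idx] card_length[of w] by simp
  then obtain zs :: "('g + 'g) list"
    where zs: "length zs = 2" "distinct (map idx zs)" "idx ` set zs \<inter> idx ` set w = {}"
    by (rule obtain_fresh_letters)
  then obtain p q where "zs = [p, q]"
    by (auto simp: length_Suc_conv numeral_2_eq_2)
  with zs show ?thesis
    by (intro that[of p q]) auto
qed

text \<open>Exchanging \<open>p\<close>, \<open>q\<close> for their partners keeps the coefficients
  on the right, by rotation of two-letter words, but reverses the signs. So the left side equals its
  own negative.\<close>

lemma blk_singleton_eq_0:
  assumes "4 \<le> CARD('g)"
  shows "c (blk [a]) = 0"
proof -
  obtain p q where pq: "idx p \<noteq> idx q" "idx p \<notin> idx ` set [a, bar a]" "idx q \<notin> idx ` set [a, bar a]"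
    using obtain_fresh_pair[of "[a, bar a]"] assms by auto
  have sym: "c [bar x, x] = c [x, bar x]" for x
    using swap[of "[x]" "[bar x]"] by simp
  have "sg a * c [a, bar a] = sg p * c [p, bar p] + sg q * c [q, bar q]"
    using rel[OF pq] by (simp add: sym)
  moreover have "sg a * c [a, bar a] = - sg p * c [p, bar p] - sg q * c [q, bar q]"
    using rel[of "bar p" "bar q" a "[bar a]"] pq by (simp add: sym)
  ultimately have "sg a * c [a, bar a] = 0"
    by linarith
  then show ?thesis
    by simp
qed

text \<open>The signs are chosen so that replacing one pair by a fresh pair leaves the value
  unchanged.\<close>

definition signed :: "('g + 'g) list \<Rightarrow> rat"
  where "signed xs = prod_list (map sg xs) * c (blk xs)"

lemma signed_swap: "signed (xs @ ys) = signed (ys @ xs)"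
  using swap[of "blk xs" "blk ys"] by (simp add: signed_def mult_ac)

text \<open>Cyclically, \<open>x\<close> is preceded by \<open>bar (last xs)\<close>, which is not
  \<open>bar x\<close> because indices are distinct. Thus only the summand exchanging
  \<open>x\<close>, \<open>bar x\<close> for \<open>p\<close>, \<open>bar p\<close> survives. The
  cardinality bound leaves room for the auxiliary letter \<open>q\<close> of the relation.\<close>

lemma signed_replace:
  assumes "xs \<noteq> []" "distinct (map idx (x # p # xs))" "length xs + 3 \<le> CARD('g)"
  shows "signed (x # xs) = signed (p # xs)"
proof -
  have "card (idx ` set (x # p # xs)) \<le> length xs + 2"
    using card_image_le[of "set (x # p # xs)" idx] card_length[of "x # p # xs"] by simp
  then have "card (idx ` set (x # p # xs)) + 1 \<le> CARD('g)"
    using assms(3) by linarith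
  then obtain zs :: "('g + 'g) list"
    where zs: "length zs = 1" "distinct (map idx zs)" "idx ` set zs \<inter> idx ` set (x # p # xs) = {}"
    by (rule obtain_fresh_letters)
  then obtain q where "zs = [q]"
    by (auto simp: length_Suc_conv)
  with zs have q: "idx q \<notin> idx ` set (x # p # xs)"
    by auto
  have "last xs \<noteq> x"
    using assms(1,2) by auto
  then have "last (blk xs) \<noteq> bar x"
    using assms(1) by (simp add: bar_eq_iff)
  moreover have "idx p \<noteq> idx q" "idx p \<notin> idx ` set (x # bar x # blk xs)"
    "idx q \<notin> idx ` set (x # bar x # blk xs)"
    using q assms(2) by auto
  ultimately have "sg x * c (x # bar x # blk xs) = sg p * c (p # bar p # blk xs)"
    using rel[of p q x "bar x # blk xs"] assms(1) by simp
  then show ?thesis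
    by (simp add: signed_def mult_ac)
qed

text \<open>Exchange the front letter for the next letter of \<open>zs\<close>, rotate the new
  letter to the end, and repeat.\<close>

lemma signed_shift:
  assumes "length xs = length zs" "distinct (map idx (xs @ ts @ zs))" "2 \<le> length (xs @ ts)"
    "length (xs @ ts) + 2 \<le> CARD('g)"
  shows "signed (xs @ ts) = signed (ts @ zs)"
  using assms
proof (induction xs zs arbitrary: ts rule: list_induct2)
  case (Cons x xs z zs)
  have "xs @ ts \<noteq> []"
    using Cons.prems(2) by (cases xs) auto
  then have "signed ((x # xs) @ ts) = signed (z # xs @ ts)"
    using Cons.prems signed_replace[of "xs @ ts" x z] by (simp add: Int_Un_distrib)
  also have "\<dots> = signed (xs @ ts @ [z])"
    using signed_swap[of "[z]" "xs @ ts"] by simp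
  also have "\<dots> = signed ((ts @ [z]) @ zs)"
    by (rule Cons.IH) (use Cons.prems in auto)
  finally show ?case
    by simp
qed simp

text \<open>The lists may share indices, so both are compared with a third list disjoint from them;
  this accounts for \<open>3 * k\<close>.\<close>

lemma signed_eq:
  assumes "distinct (map idx xs)" "distinct (map idx ys)" "length xs = k" "length ys = k"
    "2 \<le> k" "3 * k \<le> CARD('g)"
  shows "signed xs = signed ys"
proof -
  have "card (idx ` set (xs @ ys)) \<le> 2 * k"
    using card_image_le[of "set (xs @ ys)" idx] card_length[of "xs @ ys"] assms(3,4) by simp
  then obtain zs :: "('g + 'g) list"
    where zs: "length zs = k" "distinct (map idx zs)" "idx ` set zs \<inter> idx ` set (xs @ ys) = {}"
    using obtain_fresh_letters[of "idx ` set (xs @ ys)" k] assms(6) by auto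
  have "signed xs = signed zs"
    using signed_shift[of xs zs "[]"] zs assms by auto
  moreover have "signed ys = signed zs"
    using signed_shift[of ys zs "[]"] zs assms by auto
  ultimately show ?thesis
    by simp
qed

lemma blk_eq_0_iff:
  assumes "distinct (map idx xs)" "distinct (map idx ys)" "length xs = k" "length ys = k"
    "2 \<le> k" "3 * k \<le> CARD('g)"
  shows "c (blk xs) = 0 \<longleftrightarrow> c (blk ys) = 0"
proof -
  have "prod_list (map sg zs) \<noteq> 0" for zs :: "('g + 'g) list"
    by (induction zs) auto
  then show ?thesis
    using signed_eq[OF assms] by (auto simp: signed_def)
qed

text \<open>The word is a row of finished pairs followed by a remainder \<open>r\<close>. The
  relation at the first letter \<open>a\<close> of \<open>r\<close> gives 0 unless
  \<open>bar a\<close> follows; otherwise a fresh pair replaces both, joins the finished ones, and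
  \<open>r\<close> is shorter by two.\<close>

lemma blk_append_eq_0:
  assumes base: "\<And>ys. distinct (map idx ys) \<Longrightarrow> 2 * length ys = n \<Longrightarrow> c (blk ys) = 0"
    and n: "n + 2 \<le> CARD('g)"
  shows "xs \<noteq> [] \<Longrightarrow> distinct (map idx xs) \<Longrightarrow> idx ` set xs \<inter> idx ` set r = {} \<Longrightarrow>
    length (blk xs @ r) = n \<Longrightarrow> c (blk xs @ r) = 0"
proof (induction r arbitrary: xs rule: length_induct)
  case (1 r)
  show ?case
  proof (cases r)
    case Nil
    with 1 base show ?thesis
      by simp
  next
    case (Cons a r')
    let ?w = "r' @ blk xs"
    have "c (blk xs @ r) = c (a # ?w)"
      using swap[of "blk xs" r] by (simp add: Cons)
    moreover have "c (a # ?w) = 0"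
    proof -
      obtain p q where pq: "idx p \<noteq> idx q" "idx p \<notin> idx ` set (a # ?w)" "idx q \<notin> idx ` set (a # ?w)"
        using obtain_fresh_pair[of "a # ?w"] 1 n Cons by auto
      have out: "idx a \<notin> idx ` set xs"
        using 1 Cons by auto
      \<comment> \<open>The cyclic predecessor of \<open>a\<close> belongs to a finished pair, whose
        index does not occur in \<open>r\<close>.\<close>
      then have last: "last ?w \<noteq> bar a"
        using \<open>xs \<noteq> []\<close> by (auto simp: bar_eq_iff)
      have "c (p # bar p # tl ?w) = 0" if "hd ?w = bar a"
      proof -
        have "r' \<noteq> []"
        proof
          assume "r' = []"
          then have "idx (hd xs) = idx a"
            using that \<open>xs \<noteq> []\<close> by simp
          then show False
            using out \<open>xs \<noteq> []\<close> by (metis hd_in_set imageI)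
        qed
        then obtain b r4 where r4: "r' = b # r4"
          by (cases r') auto
        have "c (blk (xs @ [p]) @ r4) = 0"
          by (rule 1(1)[rule_format]) (use 1(2-) pq Cons r4 in \<open>auto simp: image_Un\<close>)
        then show ?thesis
          using swap[of "blk xs" "p # bar p # r4"] by (simp add: r4)
      qed
      then have "sg a * c (a # ?w) = 0"
        using rel[OF pq] last by auto
      then show ?thesis
        by simp
    qed
    ultimately show ?thesis
      by simp
  qed
qed

text \<open>One use of the relation creates a first fresh pair in either summand, from which
  \<open>blk_append_eq_0\<close> can start. The pair \<open>bar q\<close>, \<open>q\<close> is the
  block of \<open>bar q\<close>.\<close>

lemma word_eq_0:
  assumes base: "\<And>ys. distinct (map idx ys) \<Longrightarrow> 2 * length ys = n \<Longrightarrow> c (blk ys) = 0"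
    and n: "2 \<le> n" "n + 2 \<le> CARD('g)" and w: "length w = n"
  shows "c w = 0"
proof -
  obtain a v where v: "w = a # v"
    using n w by (cases w) auto
  obtain p q where pq: "idx p \<noteq> idx q" "idx p \<notin> idx ` set (a # v)" "idx q \<notin> idx ` set (a # v)"
    using obtain_fresh_pair[of "a # v"] n w v by auto
  have "v \<noteq> []"
    using n w v by auto
  have "c (blk [p] @ tl v) = 0"
    by (rule blk_append_eq_0[OF base n(2)])
      (use pq w v \<open>v \<noteq> []\<close> in \<open>auto dest: list.set_sel(2)\<close>)
  moreover have "c (blk [bar q] @ butlast v) = 0"
    by (rule blk_append_eq_0[OF base n(2)])
      (use pq w v \<open>v \<noteq> []\<close> in \<open>auto dest: in_set_butlastD\<close>)
  ultimately have "sg a * c (a # v) = 0"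
    using rel[OF pq] by simp
  then show ?thesis
    by (simp add: v)
qed

end

lemma central_coeffs_center:
  assumes D: "D \<in> lie_center Der_omega" "represents u D"
  shows "central_coeffs (tcoeff u)"
proof
  show "tcoeff u (xs @ ys) = tcoeff u (ys @ xs)" for xs ys
    by (rule nu_fixed_swap, rule nu_fixed_of_Der_omega[OF _ D(2)]) (use D(1) in \<open>simp add: lie_center_def\<close>)
next
  fix a p q :: "'a + 'a" and w
  assume pq: "idx p \<noteq> idx q" "idx p \<notin> idx ` set (a # w)" "idx q \<notin> idx ` set (a # w)"
  then have neq: "p \<noteq> q" "p \<noteq> bar a" "q \<noteq> bar a" "p \<notin> set w" "q \<notin> set w"
    by auto
  have "tcoeff (letter (bar a) * left_quotient (bar p) (left_quotient p u)) w =
      (if w \<noteq> [] \<and> hd w = bar a then tcoeff u (p # bar p # tl w) else 0)"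
    by (cases w) auto
  moreover have "tcoeff (left_quotient (bar q) u * letter (bar a)) (q # w) =
      (if w \<noteq> [] \<and> last w = bar a then tcoeff u (bar q # q # butlast w) else 0)"
  proof (cases w rule: rev_cases)
    case Nil
    then show ?thesis
      \<comment> \<open>For empty \<open>w\<close> the last letter is \<open>q\<close> itself, which
        differs from \<open>bar a\<close>.\<close>
      using neq tcoeff_mult_letter(2)[of "left_quotient (bar q) u" "bar a" "[]" q] by simp
  next
    case (snoc v b)
    then show ?thesis
      using tcoeff_mult_letter(2)[of "left_quotient (bar q) u" "bar a" "q # v" b] by simp
  qed
  ultimately show "sg a * tcoeff u (a # w) =
      (if w \<noteq> [] \<and> hd w = bar a then sg p * tcoeff u (p # bar p # tl w) else 0) +
      (if w \<noteq> [] \<and> last w = bar a then sg q * tcoeff u (bar q # q # butlast w) else 0)"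
    using central_relation[OF D neq] by auto
qed

section \<open>The center in low degrees\<close>

lemma nu_omega_power_blk:
  assumes "2 \<le> length xs" "distinct (map idx xs)"
  shows "tcoeff (omega ^ length xs) (blk xs) = prod_list (map sg xs)"
    and "tcoeff (nu (omega ^ length xs)) (blk xs) = 0"
proof -
  show "tcoeff (omega ^ length xs) (blk xs) = prod_list (map sg xs)"
    by (induction xs) (auto simp: tcoeff_omega_mult)
  obtain x ys where x: "xs = x # ys" "ys \<noteq> []"
    using assms(1) by (cases xs; cases "tl xs") auto
  \<comment> \<open>Undoing the rotation puts \<open>bar (last ys)\<close> in front of
    \<open>x\<close>; these are not partners, so \<open>omega ^ length xs\<close> has coefficient 0
    there.\<close>
  have "blk xs = rotate1 (bar (last ys) # butlast (blk xs))"
    using x append_butlast_last_id[of "blk xs"] by simp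
  then have "tcoeff (nu (omega ^ length xs)) (blk xs) =
      tcoeff (omega ^ length xs) (bar (last ys) # butlast (blk xs))"
    by (metis tcoeff_nu_rotate1)
  moreover have "last ys \<noteq> x"
    using x assms(2) by auto
  ultimately show "tcoeff (nu (omega ^ length xs)) (blk xs) = 0"
    using x by (auto simp: tcoeff_omega_mult)
qed

lemma tcoeff_cyc_N_omega_power_eq_0:
  assumes "length w \<noteq> 2 * k"
  shows "tcoeff (cyc_N (omega ^ k)) w = 0"
proof -
  obtain v where v: "w = rotate1 v"
    using surj_rotate1 by blast
  with assms show ?thesis
    by (simp add: cyc_N_omega_power tcoeff_omega_power_eq_0)
qed

text \<open>Of the two summands of N only the unrotated power meets this word. For a single letter
  they would cancel, since N(\<open>omega\<close>) is zero.\<close>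

lemma tcoeff_cyc_N_omega_power_blk:
  assumes "2 \<le> length xs" "distinct (map idx xs)"
  shows "tcoeff (cyc_N (omega ^ length xs)) (blk xs) \<noteq> 0"
proof -
  have "prod_list (map sg xs) \<noteq> 0"
    by (induction xs) auto
  then show ?thesis
    using assms by (auto simp: cyc_N_omega_power nu_omega_power_blk)
qed

text \<open>The summand with index k lives in degree 2k alone, so distinct summands cannot
  cancel.\<close>

lemma sum_is_direct_omega_powers:
  "sum_is_direct I (\<lambda>k. tens.span {cyc_N (omega ^ k :: ('g::finite + 'g) tensor_alg)})"
  unfolding sum_is_direct_def
proof (intro allI impI ballI, elim conjE)
  fix F :: "nat set" and v :: "nat \<Rightarrow> ('g + 'g) tensor_alg" and k
  assume F: "finite F" "\<forall>i\<in>F. v i \<in> tens.span {cyc_N (omega ^ i)}" "(\<Sum>i\<in>F. v i) = 0" "k \<in> F"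
  have zero: "tcoeff (v i) w = 0" if "i \<in> F" "length w \<noteq> 2 * i" for i w
  proof -
    have "v i \<in> tens.span {cyc_N (omega ^ i)}"
      using F(2) that(1) by blast
    then obtain r where "v i = tscale r (cyc_N (omega ^ i))"
      by (auto simp: tens.span_singleton)
    then show ?thesis
      using that(2) by (simp add: tcoeff_cyc_N_omega_power_eq_0)
  qed
  show "v k = 0"
  proof (rule tensor_eqI)
    fix w
    have "tcoeff (v k) w = 0" if "length w = 2 * k"
    proof -
      have "(\<Sum>i\<in>F. tcoeff (v i) w) = (\<Sum>i\<in>F. if i = k then tcoeff (v k) w else 0)"
        using zero that by (intro sum.cong) auto
      then show ?thesis
        using F tcoeff_sum[of v F w] by simp
    qed
    then show "tcoeff (v k) w = tcoeff 0 w"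
      using zero[OF F(4), of w] by auto
  qed
qed

text \<open>One block word in each degree 2k controls the whole component; degrees 0, 1 and 2 vanish
  without any assumption on block words.\<close>

lemma center_vanishes:
  fixes u :: "('g::finite + 'g) tensor_alg"
  assumes D: "D \<in> lie_center Der_omega" "represents u D"
    and m: "m = (CARD('g) - 1) div 4 + 1"
    and x: "\<And>k. 2 \<le> k \<Longrightarrow> k < m \<Longrightarrow>
      distinct (map idx (xs k)) \<and> length (xs k) = k \<and> tcoeff u (blk (xs k)) = 0"
  shows "u \<in> filt (2 * m)"
  unfolding filt_def
proof (clarify)
  fix w :: "('g + 'g) list"
  assume w: "length w < 2 * m"
  interpret central_coeffs "tcoeff u"
    by (rule central_coeffs_center[OF D])
  consider "length w = 0" | "length w = 1" | "2 \<le> length w"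
    by linarith
  then show "tcoeff u w = 0"
  proof cases
    case 1
    then show ?thesis
      using D(2) by (simp add: represents_def filt_def)
  next
    case 2
    then show ?thesis
      using central_degree_1[OF D] by (auto simp: length_Suc_conv)
  next
    case 3
    \<comment> \<open>This bound on the genus yields \<open>length w + 2 \<le> CARD('g)\<close> for
      words shorter than 2m, as well as \<open>3 * k \<le> CARD('g)\<close> for k below m.\<close>
    have g: "4 * (m - 1) + 1 \<le> CARD('g)" "2 \<le> m"
      using m w 3 zero_less_card_finite[where 'a='g] by auto
    show ?thesis
    proof (rule word_eq_0[OF _ 3 _ refl])
      show "length w + 2 \<le> CARD('g)"
        using g w by linarith
      fix ys :: "('g + 'g) list"
      \<comment> \<open>In odd degree no such \<open>ys\<close> exists, so the base case is
        vacuous.\<close>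
      assume ys: "distinct (map idx ys)" "2 * length ys = length w"
      then consider "length ys = 1" | "2 \<le> length ys" "length ys < m"
        using 3 w by linarith
      then show "tcoeff u (blk ys) = 0"
      proof cases
        case 1
        then obtain a where "ys = [a]"
          by (auto simp: length_Suc_conv)
        then show ?thesis
          using blk_singleton_eq_0[of a] g by auto
      next
        case 2
        show ?thesis
          using blk_eq_0_iff[of "xs (length ys)" ys "length ys"] x[OF 2] ys(1) 2 g by auto
      qed
    qed
  qed
qed

lemma center_decomposition:
  fixes u :: "('g::finite + 'g) tensor_alg"
  assumes u: "u \<in> tensors_of (lie_center Der_omega)" and m: "m = (CARD('g) - 1) div 4 + 1"
  obtains s where "s \<in> tens.span (\<Union>k\<in>{2..}. tens.span {cyc_N (omega ^ k)})"
    "u - s \<in> cyc_N ` filt (2 * m)"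
proof -
  have "\<exists>ys :: ('g + 'g) list. distinct (map idx ys) \<and> length ys = k" if "k < m" for k
  proof -
    have "card ({} :: 'g set) + k \<le> CARD('g)"
      using that m zero_less_card_finite[where 'a='g] by auto
    then show ?thesis
      using obtain_fresh_letters by metis
  qed
  then obtain xs :: "nat \<Rightarrow> ('g + 'g) list"
    where xs: "distinct (map idx (xs k))" "length (xs k) = k" if "k < m" for k
    by metis
  define N where "N = (\<lambda>k. cyc_N (omega ^ k) :: ('g + 'g) tensor_alg)"
  \<comment> \<open>Each \<open>N k\<close> lives in degree 2k, so the multiples can be fitted
    independently, one test word per degree.\<close>
  define r where "r = (\<lambda>k. tcoeff u (blk (xs k)) / tcoeff (N k) (blk (xs k)))"
  define s where "s = (\<Sum>k\<in>{2..<m}. tscale (r k) (N k))"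
  have "s \<in> tens.span (\<Union>k\<in>{2..}. tens.span {N k})"
    unfolding s_def
    by (intro tens.span_sum tens.span_scale tens.span_base) (auto intro: tens.span_base)
  moreover have "u - s \<in> cyc_N ` filt (2 * m)"
  proof -
    \<comment> \<open>Subtracting \<open>s\<close> stays inside the center, so the vanishing result
      applies to the difference.\<close>
    have "s \<in> tensors_of (lie_center Der_omega)"
      unfolding s_def N_def
      by (intro tens.subspace_sum tens.subspace_scale subspace_tensors_of_center
          cyc_N_omega_power_central) auto
    then have "u - s \<in> tensors_of (lie_center Der_omega)"
      using u tens.subspace_diff[OF subspace_tensors_of_center] by blast
    then obtain D where D: "D \<in> lie_center Der_omega" "represents (u - s) D"
      by (subst (asm) tensors_of_iff) (auto simp: lie_center_def)
    have "tcoeff (u - s) (blk (xs k)) = 0" if k: "2 \<le> k" "k < m" for k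
    proof -
      have "tcoeff s (blk (xs k)) =
          (\<Sum>j\<in>{2..<m}. if j = k then r k * tcoeff (N k) (blk (xs k)) else 0)"
        unfolding s_def tcoeff_sum
        by (rule sum.cong) (use xs k in \<open>auto simp: N_def tcoeff_cyc_N_omega_power_eq_0\<close>)
      moreover have "tcoeff (N k) (blk (xs k)) \<noteq> 0"
        using tcoeff_cyc_N_omega_power_blk[of "xs k"] xs[OF k(2)] k(1) by (simp add: N_def)
      ultimately show ?thesis
        using k by (simp add: r_def)
    qed
    then have "u - s \<in> filt (2 * m)"
      using center_vanishes[OF D m, of xs] xs by blast
    moreover have "nu (u - s) = u - s"
      using nu_fixed_of_Der_omega[OF _ D(2)] D(1) by (simp add: lie_center_def)
    ultimately show ?thesis
      by (intro nu_fixed_in_cyc_N_filt) (auto simp: m)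
  qed
  ultimately show ?thesis
    using that by (simp add: N_def)
qed

theorem theorem3p2p8:
  fixes g m :: nat
  assumes "g \<ge> 1" and "CARD('g::finite) = g" and "m = (g - 1) div 4 + 1"
  shows "sum_is_direct {2..} (\<lambda>k. tens.span {cyc_N (omega ^ k :: ('g + 'g) tensor_alg)}) \<and>
    tensors_of (lie_center (Der_omega :: (('g + 'g) tensor_alg \<Rightarrow> ('g + 'g) tensor_alg) set))
        + cyc_N ` filt (2 * m)
      = subspace_sum {2..} (\<lambda>k. tens.span {cyc_N (omega ^ k)}) + cyc_N ` filt (2 * m)"
proof (intro conjI sum_is_direct_omega_powers)
  let ?Z = "tensors_of (lie_center (Der_omega :: (('g + 'g) tensor_alg \<Rightarrow> _) set))"
  let ?S = "subspace_sum {2..} (\<lambda>k. tens.span {cyc_N (omega ^ k :: ('g + 'g) tensor_alg)})"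
  let ?F = "cyc_N ` filt (2 * m) :: ('g + 'g) tensor_alg set"
  have "?S \<subseteq> ?Z"
    unfolding subspace_sum_def
  proof (rule tens.span_minimal[OF UN_least subspace_tensors_of_center])
    show "tens.span {cyc_N (omega ^ k)} \<subseteq> ?Z" if "k \<in> {2..}" for k
      using that
      by (intro tens.span_minimal subspace_tensors_of_center) (auto intro: cyc_N_omega_power_central)
  qed
  then have "?S + ?F \<subseteq> ?Z + ?F"
    by (intro set_plus_mono2) auto
  moreover have "?Z + ?F \<subseteq> ?S + ?F"
  proof
    fix z
    assume "z \<in> ?Z + ?F"
    then obtain u t where u: "u \<in> ?Z" and t: "t \<in> filt (2 * m)" and z: "z = u + cyc_N t"
      by (auto elim!: set_plus_elim)
    obtain s where s: "s \<in> ?S" "u - s \<in> ?F"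
      using center_decomposition[OF u, of m] assms(2,3) by (auto simp: subspace_sum_def)
    then obtain t' where t': "t' \<in> filt (2 * m)" "u - s = cyc_N t'"
      by auto
    have "t' + t \<in> filt (2 * m)"
      using t t' by (simp add: filt_def)
    moreover have "z = s + cyc_N (t' + t)"
      using t'(2) by (simp add: z algebra_simps)
    ultimately show "z \<in> ?S + ?F"
      using s(1) by (simp only: set_plus_intro imageI)
  qed
  ultimately show "?Z + ?F = ?S + ?F"
    by blast
qed

end
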